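(* Let $F$ be an outer function in the disk algebra $\mathcal A=H^\infty\cap C(\mathbb T)$ and let $I$ be an inner function. Then the product $IF$ is $G$-extremal if and only if $\mathcal M(F)\cap\sigma(I)\neq\emptyset$.
   Context: $\mathbb D=\{z\in\mathbb C:|z|<1\}$, $\mathbb T=\partial\mathbb D$, $m$ is normalized arc length measure on $\mathbb T$, $L^p=L^p(\mathbb T,m)$. For $f\in L^1$, the Poisson integral is $\mathcal Pf(z)=\int_{\mathbb T}f(\zeta)\frac{1-|z|^2}{|\zeta-z|^2}\,dm(\zeta)$, $z\in\mathbb D$. $H^\infty$ is the set of $f\in L^\infty$ with $\mathcal Pf$ analytic on $\mathbb D$; such $f$ is identified with its analytic extension $\mathcal Pf$. A function $F\in\mathcal A$ is regarded as a continuous function on $\mathbb D\cup\mathbb T$. For $f\in L^2$ put $\Phi_f(z)=\mathcal P(|f|^2)(z)-|\mathcal Pf(z)|^2$, $z\in\mathbb D$, and $\|f\|_G=\sup_{z\in\mathbb D}\Phi_f(z)^{1/2}$ (the Garsia norm). A function $f\in L^\infty$ is called $G$-extremal if $\|f\|_G=\|f\|_\infty$. An inner function is a function $I\in H^\infty$ with $|I|=1$ a.e. on $\mathbb T$. An analytic function $F$ on $\mathbb D$ is outer if it is zero-free and $\log|F(z)|$ is the Poisson integral of an $L^1$ function on $\mathbb T$. For $F\in\mathcal A$, $\mathcal M(F):=\{z\in\mathbb D\cup\mathbb T:\ |F(z)|=\|F\|_\infty\}$. For an inner function $I$, its spectrum is $\sigma(I):=\{z\in\mathbb D\cup\mathbb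 T:\ \liminf_{\mathbb D\ni w\to z}|I(w)|=0\}$. *)

theory Defs
  imports "HOL-Complex_Analysis.Complex_Analysis" "HOL-Probability.Essential_Supremum"
begin

definition arc_measure :: "complex measure" where
  "arc_measure = distr (uniform_measure lborel {0..2 * pi}) (restrict_space borel (sphere 0 1)) cis"

text \<open>Elements of the Lebesgue spaces over the circle are represented by functions on the complex
  plane, of which only the values on the unit circle matter. Only \<open>disk_algebra\<close> and
  \<open>closed_disk_ext\<close> depend on the representative, which is then the continuous one.\<close>

definition poisson :: "(complex \<Rightarrow> 'a::{banach, second_countable_topology}) \<Rightarrow> complex \<Rightarrow> 'a" where
  "poisson f z = (LINT \<zeta>|arc_measure. ((1 - (cmod z)\<^sup>2) / (cmod (\<zeta> - z))\<^sup>2) *\<^sub>R f \<zeta>)"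

definition sup_norm :: "(complex \<Rightarrow> complex) \<Rightarrow> ereal" where
  "sup_norm f = esssup arc_measure (\<lambda>\<zeta>. ereal (cmod (f \<zeta>)))"

definition L_infinity :: "(complex \<Rightarrow> complex) set" where
  "L_infinity = {f \<in> borel_measurable arc_measure. sup_norm f < \<infinity>}"

definition H_infinity :: "(complex \<Rightarrow> complex) set" where
  "H_infinity = {f \<in> L_infinity. poisson f analytic_on ball 0 1}"

definition disk_algebra :: "(complex \<Rightarrow> complex) set" where
  "disk_algebra = {f \<in> H_infinity. continuous_on (sphere 0 1) f}"

text \<open>For \<open>f\<close> in the disk algebra, this is \<open>f\<close> regarded as a continuous function on the closed disk.\<close>

definition closed_disk_ext :: "(complex \<Rightarrow> complex) \<Rightarrow> complex \<Rightarrow> complex" where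
  "closed_disk_ext f z = (if z \<in> ball 0 1 then poisson f z else f z)"

definition garsia_Phi :: "(complex \<Rightarrow> complex) \<Rightarrow> complex \<Rightarrow> real" where
  "garsia_Phi f z = poisson (\<lambda>\<zeta>. (cmod (f \<zeta>))\<^sup>2) z - (cmod (poisson f z))\<^sup>2"

definition garsia_norm :: "(complex \<Rightarrow> complex) \<Rightarrow> ereal" where
  "garsia_norm f = (SUP z\<in>ball 0 1. ereal (sqrt (garsia_Phi f z)))"

definition G_extremal :: "(complex \<Rightarrow> complex) \<Rightarrow> bool" where
  "G_extremal f \<longleftrightarrow> f \<in> L_infinity \<and> garsia_norm f = sup_norm f"

definition inner_function :: "(complex \<Rightarrow> complex) \<Rightarrow> bool" where
  "inner_function I \<longleftrightarrow> I \<in> H_infinity \<and> (AE \<zeta> in arc_measure. cmod (I \<zeta>) = 1)"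

text \<open>A predicate on functions on the open disk, not on boundary functions.\<close>

definition outer_on_disk :: "(complex \<Rightarrow> complex) \<Rightarrow> bool" where
  "outer_on_disk F \<longleftrightarrow> F analytic_on ball 0 1 \<and> (\<forall>z\<in>ball 0 1. F z \<noteq> 0) \<and>
     (\<exists>u :: complex \<Rightarrow> real. integrable arc_measure u \<and>
        (\<forall>z\<in>ball 0 1. ln (cmod (F z)) = poisson u z))"

definition max_modulus_set :: "(complex \<Rightarrow> complex) \<Rightarrow> complex set" where
  "max_modulus_set F = {z \<in> cball 0 1. ereal (cmod (closed_disk_ext F z)) = sup_norm F}"

definition spectrum_inner :: "(complex \<Rightarrow> complex) \<Rightarrow> complex set" where
  "spectrum_inner I =
     {z \<in> cball 0 1. Liminf (at z within ball 0 1) (\<lambda>w. ereal (cmod (poisson I w))) = 0}"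

end

theory Submission
  imports Defs "HOL-Probability.Probability_Measure"
begin

text \<open>Let $M=\|F\|_\infty>0$ and $f=IF$. As $|I|=1$ almost everywhere and the Poisson integral
  multiplies $I$ and $F$ (\<open>poisson_mult_holomorphic\<close>),
  \[\Phi_f=\mathcal P(|F|^2)-|\mathcal PI|^2\,|\mathcal PF|^2\le\mathcal P(|F|^2)\le M^2.\]
  So $f$ is $G$-extremal if and only if along some sequence $z_n$ in the disk both
  $\mathcal P(|F|^2)(z_n)\to M^2$ and $\mathcal PI(z_n)\,\mathcal PF(z_n)\to 0$.

  If $z_0\in\mathcal M(F)\cap\sigma(I)$, points near $z_0$ at which $\mathcal PI$ is small provide such a
  sequence: $\mathcal P(|F|^2)$ is continuous on the closed disk (\<open>continuous_on_poisson_ext\<close>) and, by the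
  Cauchy--Schwarz inequality (\<open>garsia_Phi_nonneg\<close>), at least $|F|^2$, hence at least $M^2$ at $z_0$.

  Conversely, let $z_0$ be a limit point of such a sequence. By continuity $\mathcal P(|F|^2)$ equals $M^2$
  at $z_0$. The point is that this forces $|F(z_0)|=M$ also when $z_0$ lies in the open disk
  (\<open>cmod_poisson_ext_eq_max\<close>); there the outerness of $F$ enters, through the absence of zeros.
  Then $\mathcal PF(z_n)$ stays away from $0$, so $\mathcal PI(z_n)\to 0$ and $z_0\in\sigma(I)$.

  Multiplicativity is obtained without Fourier series. The dilations $\mathcal PI(r\,\cdot)$ are continuous
  on the closed disk, where the Cauchy formula applies to products (\<open>poisson_holomorphic\<close>). By symmetry of
  the kernel a dilation can be moved from $I$ to the continuous function it is integrated against
  (\<open>poisson_dilation_adjoint\<close>), and there the limit $r\to 1$ is harmless.\<close>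

section \<open>The normalized arc length measure\<close>

lemma space_arc_measure [simp]: "space arc_measure = sphere 0 1"
  by (simp add: arc_measure_def space_restrict_space)

lemma sets_arc_measure [measurable_cong]:
  "sets arc_measure = sets (restrict_space borel (sphere 0 1))"
  by (simp add: arc_measure_def)

lemma cis_measurable [measurable]: "cis \<in> lborel \<rightarrow>\<^sub>M restrict_space borel (sphere 0 1)"
  by (intro measurable_restrict_space2)
     (auto intro!: borel_measurable_continuous_onI continuous_intros)

lemma cis_measurable_uniform:
  "cis \<in> uniform_measure lborel {0..2 * pi} \<rightarrow>\<^sub>M restrict_space borel (sphere 0 1)"
  using cis_measurable by (simp cong: measurable_cong_sets)

interpretation arc: prob_space arc_measure
  unfolding arc_measure_def
  by (intro prob_space.prob_space_distr prob_space_uniform_measure cis_measurable_uniform) auto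

lemma borel_measurable_continuous_on_circle:
  fixes f :: "complex \<Rightarrow> 'a::topological_space"
  shows "continuous_on (sphere 0 1) f \<Longrightarrow> f \<in> borel_measurable arc_measure"
  using borel_measurable_continuous_on_restrict[of "sphere 0 1" f]
  by (simp cong: measurable_cong_sets add: sets_arc_measure)

lemma borel_measurable_id_arc [measurable]: "(\<lambda>\<zeta>. \<zeta>) \<in> borel_measurable arc_measure"
  by (intro borel_measurable_continuous_on_circle continuous_intros)

lemma integral_arc_measure:
  fixes f :: "complex \<Rightarrow> complex"
  assumes "continuous_on (sphere 0 1) f"
  shows "(LINT \<zeta>|arc_measure. f \<zeta>) = integral {0..2*pi} (\<lambda>t. f (cis t)) / (2 * pi)"
proof -
  have c: "continuous_on {0..2*pi} (\<lambda>t. f (cis t))"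
    by (rule continuous_on_compose2[OF assms]) (auto intro!: continuous_intros)
  have f: "f \<in> borel_measurable (restrict_space borel (sphere 0 1))"
    using assms by (rule borel_measurable_continuous_on_restrict)
  have fc: "(\<lambda>t. f (cis t)) \<in> borel_measurable lborel"
    using measurable_compose[OF cis_measurable f] .
  have "(LINT \<zeta>|arc_measure. f \<zeta>) = (LINT t|uniform_measure lborel {0..2*pi}. f (cis t))"
    unfolding arc_measure_def by (rule integral_distr[OF cis_measurable_uniform f])
  also have "uniform_measure lborel {0..2*pi} =
      density lborel (\<lambda>t. ennreal (indicator {0..2*pi} t / (2*pi)))"
    unfolding uniform_measure_def
    by (intro arg_cong2[where f=density] refl ext)
       (auto simp: indicator_def divide_ennreal[symmetric])
  also have "(LINT t|\<dots>. f (cis t)) = (LINT t|lborel. (indicator {0..2*pi} t / (2*pi)) *\<^sub>R f (cis t))"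
    by (rule integral_density[OF fc]) auto
  also have "\<dots> = (LINT t|lborel. (indicator {0..2*pi} t *\<^sub>R f (cis t)) / (2*pi))"
    by (intro Bochner_Integration.integral_cong refl) (auto simp: indicator_def scaleR_conv_of_real)
  also have "\<dots> = (LINT t:{0..2*pi}|lborel. f (cis t)) / (2*pi)"
    unfolding set_lebesgue_integral_def by (rule integral_divide_zero)
  also have "(LINT t:{0..2*pi}|lborel. f (cis t)) = integral {0..2*pi} (\<lambda>t. f (cis t))"
    by (rule set_borel_integral_eq_integral(2)[OF borel_integrable_atLeastAtMost'[OF c]])
  finally show ?thesis .
qed

section \<open>The Poisson kernel\<close>

definition poisson_kernel :: "complex \<Rightarrow> complex \<Rightarrow> real" where
  "poisson_kernel z \<zeta> = (1 - (cmod z)\<^sup>2) / (cmod (\<zeta> - z))\<^sup>2"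

lemma poisson_eq: "poisson f z = (LINT \<zeta>|arc_measure. poisson_kernel z \<zeta> *\<^sub>R f \<zeta>)"
  by (simp add: poisson_def poisson_kernel_def)

lemma poisson_cong_AE:
  assumes "f \<in> borel_measurable arc_measure" "g \<in> borel_measurable arc_measure"
    and "AE \<zeta> in arc_measure. f \<zeta> = g \<zeta>"
  shows "poisson f z = poisson g z"
  unfolding poisson_eq
  using assms by (intro integral_cong_AE) (auto simp: poisson_kernel_def[abs_def])

lemma poisson_cong: "(\<And>\<zeta>. cmod \<zeta> = 1 \<Longrightarrow> f \<zeta> = g \<zeta>) \<Longrightarrow> poisson f z = poisson g z"
  unfolding poisson_eq by (intro Bochner_Integration.integral_cong refl) auto

lemma poisson_kernel_nonneg: "cmod z < 1 \<Longrightarrow> 0 \<le> poisson_kernel z \<zeta>"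
  by (auto simp: poisson_kernel_def power_le_one_iff abs_square_le_1)

lemma poisson_kernel_pos: "cmod z < 1 \<Longrightarrow> cmod \<zeta> = 1 \<Longrightarrow> 0 < poisson_kernel z \<zeta>"
  unfolding poisson_kernel_def by (intro divide_pos_pos) (auto simp: abs_square_less_1)

lemma poisson_kernel_le:
  assumes "cmod z \<le> r" "r < 1" "cmod \<zeta> = 1"
  shows "poisson_kernel z \<zeta> \<le> 1 / (1 - r)\<^sup>2"
  unfolding poisson_kernel_def
proof (rule frac_le)
  have "1 - r \<le> cmod (\<zeta> - z)"
    using norm_triangle_ineq2[of \<zeta> z] assms by simp
  thus "(1 - r)\<^sup>2 \<le> (cmod (\<zeta> - z))\<^sup>2"
    using assms by (intro power_mono) auto
qed (use assms in auto)

lemma norm_poisson_kernel_scaleR_le: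
  assumes "cmod z \<le> r" "r < 1" "cmod \<zeta> = 1" "norm x \<le> B"
  shows "norm (poisson_kernel z \<zeta> *\<^sub>R x) \<le> 1 / (1 - r)\<^sup>2 * B"
proof -
  have "\<bar>poisson_kernel z \<zeta>\<bar> \<le> 1 / (1 - r)\<^sup>2"
    using poisson_kernel_le[of z r \<zeta>] poisson_kernel_nonneg[of z \<zeta>] assms by auto
  thus ?thesis
    unfolding norm_scaleR using assms(4) by (intro mult_mono) auto
qed

text \<open>For $|\xi|=|\zeta|=1$ the distances $|\zeta-r\xi|$ and $|\xi-r\zeta|$ agree: multiplication by
  $\bar\zeta\bar\xi$ takes $\zeta-r\xi$ to the conjugate of $\xi-r\zeta$.\<close>

lemma poisson_kernel_symmetric:
  assumes "cmod \<xi> = 1" "cmod \<zeta> = 1"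
  shows "poisson_kernel (of_real r * \<xi>) \<zeta> = poisson_kernel (of_real r * \<zeta>) \<xi>"
proof -
  have x: "\<xi> * cnj \<xi> = 1" and z: "\<zeta> * cnj \<zeta> = 1"
    using assms by (simp_all add: complex_norm_square[symmetric])
  have "cmod (\<zeta> - of_real r * \<xi>) = cmod ((\<zeta> - of_real r * \<xi>) * (cnj \<zeta> * cnj \<xi>))"
    using assms by (simp add: norm_mult)
  also have "(\<zeta> - of_real r * \<xi>) * (cnj \<zeta> * cnj \<xi>)
      = (\<zeta> * cnj \<zeta>) * cnj \<xi> - of_real r * (\<xi> * cnj \<xi>) * cnj \<zeta>"
    by (simp add: algebra_simps)
  also have "\<dots> = cnj (\<xi> - of_real r * \<zeta>)"
    by (simp add: x z)
  also have "cmod \<dots> = cmod (\<xi> - of_real r * \<zeta>)"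
    by (rule complex_mod_cnj)
  finally show ?thesis
    using assms by (simp add: poisson_kernel_def norm_mult)
qed

lemma poisson_kernel_eq_Cauchy:
  assumes "cmod z < 1" "cmod \<zeta> = 1"
  shows "complex_of_real (poisson_kernel z \<zeta>) = (1 - of_real ((cmod z)\<^sup>2)) / (1 - cnj z * \<zeta>) / (\<zeta> - z) * \<zeta>"
proof -
  have x: "\<zeta> * cnj \<zeta> = 1"
    using assms by (simp add: complex_norm_square[symmetric])
  have ne: "\<zeta> \<noteq> z" "\<zeta> \<noteq> 0" "1 - cnj z * \<zeta> \<noteq> 0"
    using assms by (auto dest!: arg_cong[where f=cmod] simp: norm_mult)
  have "complex_of_real ((cmod (\<zeta> - z))\<^sup>2) * \<zeta> = (\<zeta> - z) * ((cnj \<zeta> * \<zeta>) - cnj z * \<zeta>)"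
    unfolding complex_norm_square by (simp add: algebra_simps)
  hence "complex_of_real ((cmod (\<zeta> - z))\<^sup>2) * \<zeta> = (\<zeta> - z) * (1 - cnj z * \<zeta>)"
    using x by (simp add: mult.commute)
  moreover have "complex_of_real ((cmod (\<zeta> - z))\<^sup>2) \<noteq> 0" using ne by simp
  ultimately show ?thesis
    unfolding poisson_kernel_def of_real_divide using ne
    by (simp add: divide_simps) (simp add: algebra_simps)
qed

lemma continuous_on_poisson_kernel:
  "cmod z < 1 \<Longrightarrow> continuous_on (sphere 0 1) (poisson_kernel z)"
  unfolding poisson_kernel_def by (intro continuous_intros) auto

lemma poisson_kernel_measurable [measurable]:
  "poisson_kernel z \<in> borel_measurable arc_measure"
  unfolding poisson_kernel_def by measurable

text \<open>Multiplying $g$ by $(1-|z|^2)/(1-\bar z\zeta)$, which is analytic in $\zeta$ and equal to $1$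
  at $\zeta=z$, turns the Cauchy kernel at $z$ into the Poisson kernel.\<close>

theorem poisson_holomorphic:
  assumes g: "continuous_on (cball 0 1) g" "g holomorphic_on ball 0 1" and z: "cmod z < 1"
  shows "poisson g z = g z"
proof -
  define h where "h \<zeta> = g \<zeta> * ((1 - of_real ((cmod z)\<^sup>2)) / (1 - cnj z * \<zeta>))" for \<zeta>
  have ne: "1 - cnj z * \<zeta> \<noteq> 0" if "cmod \<zeta> \<le> 1" for \<zeta>
  proof -
    have "cmod (cnj z * \<zeta>) \<le> cmod z * 1"
      unfolding norm_mult complex_mod_cnj using that by (intro mult_left_mono) auto
    thus ?thesis using z by auto
  qed
  have zz: "1 - complex_of_real ((cmod z)\<^sup>2) = 1 - cnj z * z"
    by (simp only: complex_norm_square mult.commute)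
  have "((\<lambda>u. h u / (u - z)) has_contour_integral (2 * of_real pi * \<i> * h z)) (circlepath 0 1)"
  proof (rule Cauchy_integral_circlepath)
    show "continuous_on (cball 0 1) h"
      unfolding h_def using ne by (intro continuous_intros g) auto
    show "h holomorphic_on ball 0 1"
      unfolding h_def using ne by (intro holomorphic_intros g) auto
  qed (use z in auto)
  hence "((\<lambda>t. h (cis t) / (cis t - z) * \<i> * cis t) has_integral (2 * of_real pi * \<i> * h z)) {0..2*pi}"
    unfolding circlepath_def by (subst (asm) has_contour_integral_part_circlepath_iff) auto
  hence *: "((\<lambda>t. (1/\<i>) * (h (cis t) / (cis t - z) * \<i> * cis t)) has_integral
      (1/\<i>) * (2 * of_real pi * \<i> * h z)) {0..2*pi}"
    by (rule has_integral_mult_right)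
  have i_cancel: "(1/\<i>) * (x * \<i> * y) = x * y" for x y :: complex
  proof -
    have "(1/\<i>) * (x * \<i> * y) = (1/\<i> * \<i>) * (x * y)"
      by (simp only: mult_ac)
    thus ?thesis by simp
  qed
  have **: "(1/\<i>) * (h (cis t) / (cis t - z) * \<i> * cis t) = poisson_kernel z (cis t) *\<^sub>R g (cis t)" for t
  proof -
    have "(1/\<i>) * (h (cis t) / (cis t - z) * \<i> * cis t) = h (cis t) / (cis t - z) * cis t"
      by (rule i_cancel)
    thus ?thesis
      unfolding scaleR_conv_of_real
      by (subst poisson_kernel_eq_Cauchy) (use z in \<open>simp_all add: h_def mult_ac\<close>)
  qed
  have "((\<lambda>t. poisson_kernel z (cis t) *\<^sub>R g (cis t)) has_integral 2 * of_real pi * h z) {0..2*pi}"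
    using *[unfolded **, unfolded i_cancel] .
  moreover have "continuous_on (sphere 0 1) (\<lambda>\<zeta>. poisson_kernel z \<zeta> *\<^sub>R g \<zeta>)"
    by (intro continuous_intros continuous_on_poisson_kernel z continuous_on_subset[OF g(1)]) auto
  ultimately have "poisson g z = h z"
    unfolding poisson_eq by (simp add: integral_arc_measure integral_unique)
  also have "h z = g z"
    using ne[of z] z unfolding h_def zz by simp
  finally show ?thesis .
qed


lemma poisson_kernel_integral:
  assumes "cmod z < 1"
  shows "(LINT \<zeta>|arc_measure. poisson_kernel z \<zeta>) = 1"
proof -
  have "poisson (\<lambda>_. 1 :: complex) z = 1"
    using assms by (intro poisson_holomorphic) auto
  thus ?thesis
    by (simp add: poisson_eq scaleR_conv_of_real)
qed

lemma integrable_poisson: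
  fixes f :: "complex \<Rightarrow> 'a::{banach, second_countable_topology}"
  assumes f: "f \<in> borel_measurable arc_measure" "AE \<zeta> in arc_measure. norm (f \<zeta>) \<le> B"
    and z: "cmod z < 1"
  shows "integrable arc_measure (\<lambda>\<zeta>. poisson_kernel z \<zeta> *\<^sub>R f \<zeta>)"
proof (rule arc.integrable_const_bound)
  show "AE \<zeta> in arc_measure. norm (poisson_kernel z \<zeta> *\<^sub>R f \<zeta>) \<le> 1 / (1 - cmod z)\<^sup>2 * B"
    using f(2) AE_space
  proof eventually_elim
    case (elim \<zeta>)
    thus ?case
      using z by (intro norm_poisson_kernel_scaleR_le) auto
  qed
qed (use f in measurable)

lemma integrable_poisson_kernel:
  "cmod z < 1 \<Longrightarrow> integrable arc_measure (poisson_kernel z)"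
  using integrable_poisson[of "\<lambda>_. 1 :: real" 1 z] by simp

lemma poisson_const:
  assumes "cmod z < 1"
  shows "poisson (\<lambda>_. c) z = c"
  unfolding poisson_eq
  using integrable_poisson_kernel[OF assms] by (simp add: poisson_kernel_integral assms)

lemma poisson_mono_AE:
  fixes f g :: "complex \<Rightarrow> real"
  assumes "f \<in> borel_measurable arc_measure" "AE \<zeta> in arc_measure. \<bar>f \<zeta>\<bar> \<le> A"
    and "g \<in> borel_measurable arc_measure" "AE \<zeta> in arc_measure. \<bar>g \<zeta>\<bar> \<le> B"
    and le: "AE \<zeta> in arc_measure. f \<zeta> \<le> g \<zeta>" and z: "cmod z < 1"
  shows "poisson f z \<le> poisson g z"
  unfolding poisson_eq
proof (rule integral_mono_AE)
  show "AE \<zeta> in arc_measure. poisson_kernel z \<zeta> *\<^sub>R f \<zeta> \<le> poisson_kernel z \<zeta> *\<^sub>R g \<zeta>"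
    using le by eventually_elim (use poisson_kernel_nonneg[OF z] in \<open>auto intro: mult_left_mono\<close>)
  show "integrable arc_measure (\<lambda>\<zeta>. poisson_kernel z \<zeta> *\<^sub>R f \<zeta>)"
    using assms by (intro integrable_poisson[where B=A]) auto
  show "integrable arc_measure (\<lambda>\<zeta>. poisson_kernel z \<zeta> *\<^sub>R g \<zeta>)"
    using assms by (intro integrable_poisson[where B=B]) auto
qed

lemma norm_poisson_le_poisson_norm:
  assumes z: "cmod z < 1"
  shows "norm (poisson f z) \<le> poisson (\<lambda>\<zeta>. norm (f \<zeta>)) z"
proof -
  have "norm (poisson f z) \<le> (LINT \<zeta>|arc_measure. norm (poisson_kernel z \<zeta> *\<^sub>R f \<zeta>))"
    unfolding poisson_eq by (rule integral_norm_bound)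
  also have "\<dots> = poisson (\<lambda>\<zeta>. norm (f \<zeta>)) z"
    unfolding poisson_eq using poisson_kernel_nonneg[OF z] by simp
  finally show ?thesis .
qed

lemma norm_poisson_le:
  assumes f: "f \<in> borel_measurable arc_measure" "AE \<zeta> in arc_measure. norm (f \<zeta>) \<le> B"
    and z: "cmod z < 1"
  shows "norm (poisson f z) \<le> B"
proof -
  note norm_poisson_le_poisson_norm[OF z]
  also have "poisson (\<lambda>\<zeta>. norm (f \<zeta>)) z \<le> poisson (\<lambda>_. B) z"
    by (rule poisson_mono_AE[where A=B and B="\<bar>B\<bar>"]) (use f z in auto)
  also have "\<dots> = B"
    using z by (rule poisson_const)
  finally show ?thesis .
qed

section \<open>Boundary behaviour\<close>

lemma continuous_on_circle_bounded:
  fixes f :: "complex \<Rightarrow> 'a::real_normed_vector"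
  assumes "continuous_on (sphere 0 1) f"
  obtains B where "0 \<le> B" "\<And>\<zeta>. cmod \<zeta> = 1 \<Longrightarrow> norm (f \<zeta>) \<le> B"
proof -
  have "compact (f ` sphere 0 1)"
    using assms by (intro compact_continuous_image) auto
  then obtain B where B: "\<forall>x\<in>f ` sphere 0 1. norm x \<le> B"
    using bounded_iff compact_imp_bounded by blast
  have "norm (f 1) \<le> B" using B by auto
  hence "0 \<le> B" using norm_ge_zero order_trans by blast
  with B show ?thesis by (intro that[of B]) auto
qed

lemma continuous_on_poisson:
  fixes f :: "complex \<Rightarrow> 'a::{banach, second_countable_topology}"
  assumes f: "f \<in> borel_measurable arc_measure" "AE \<zeta> in arc_measure. norm (f \<zeta>) \<le> B"
  shows "continuous_on (ball 0 1) (poisson f)"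
proof -
  \<comment> \<open>The kernels are uniformly bounded only on closed disks of radius less than \<open>1\<close>.\<close>
  have *: "continuous_on (cball 0 r) (poisson f)" if "r < 1" for r
    unfolding continuous_on_sequentially
  proof (intro allI ballI impI, elim conjE)
    fix x :: "nat \<Rightarrow> complex" and a assume a: "a \<in> cball 0 r" and x: "\<forall>n. x n \<in> cball 0 r" "x \<longlonglongrightarrow> a"
    have "(\<lambda>n. poisson f (x n)) \<longlonglongrightarrow> poisson f a"
      unfolding poisson_eq
    proof (rule integral_dominated_convergence)
      show "AE \<zeta> in arc_measure. norm (poisson_kernel (x n) \<zeta> *\<^sub>R f \<zeta>) \<le> 1 / (1 - r)\<^sup>2 * B" for n
        using f(2) AE_space
      proof eventually_elim
        case (elim \<zeta>)
        thus ?case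
          using that x by (intro norm_poisson_kernel_scaleR_le) auto
      qed
      show "AE \<zeta> in arc_measure. (\<lambda>n. poisson_kernel (x n) \<zeta> *\<^sub>R f \<zeta>) \<longlonglongrightarrow> poisson_kernel a \<zeta> *\<^sub>R f \<zeta>"
        using AE_space
      proof eventually_elim
        case (elim \<zeta>)
        thus ?case unfolding poisson_kernel_def
          using x a that by (intro tendsto_intros) auto
      qed
    qed (use f in auto)
    thus "(poisson f \<circ> x) \<longlonglongrightarrow> poisson f a" by (simp add: o_def)
  qed
  show ?thesis
  proof (intro continuous_at_imp_continuous_on ballI)
    fix z :: complex assume "z \<in> ball 0 1"
    hence z: "cmod z < 1" by simp
    show "isCont (poisson f) z"
      by (rule continuous_on_interior[OF *[of "(1 + cmod z) / 2"]]) (use z in auto)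
  qed
qed

text \<open>The kernels \<open>poisson_kernel w\<close> form an approximate identity as $w\to z_0$: they are positive of
  mass $1$, and at distance at least $\delta$ from $z_0$ they are at most $4(1-|w|^2)/\delta^2$
  once $|w-z_0|<\delta/2$.\<close>

lemma tendsto_poisson_boundary:
  fixes f :: "complex \<Rightarrow> 'a::{banach, second_countable_topology}"
  assumes f: "continuous_on (sphere 0 1) f" and z0: "cmod z0 = 1"
  shows "(poisson f \<longlongrightarrow> f z0) (at z0 within ball 0 1)"
proof (rule tendstoI)
  fix \<epsilon> :: real assume \<epsilon>: "\<epsilon> > 0"
  obtain B where B: "0 \<le> B" "\<And>\<zeta>. cmod \<zeta> = 1 \<Longrightarrow> norm (f \<zeta>) \<le> B"
    using continuous_on_circle_bounded[OF f] by blast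
  obtain \<delta> where \<delta>: "\<delta> > 0" "\<And>\<zeta>. cmod \<zeta> = 1 \<Longrightarrow> dist \<zeta> z0 < \<delta> \<Longrightarrow> dist (f \<zeta>) (f z0) < \<epsilon> / 2"
    using f[unfolded continuous_on_iff, rule_format, of z0 "\<epsilon>/2"] z0 \<epsilon> by auto
  define C where "C w = 2 * B * ((1 - (cmod w)\<^sup>2) / (\<delta> / 2)\<^sup>2)" for w :: complex
  have fm: "f \<in> borel_measurable arc_measure"
    using f by (rule borel_measurable_continuous_on_circle)
  have main: "dist (poisson f w) (f z0) \<le> \<epsilon> / 2 + C w" if w: "cmod w < 1" "dist w z0 < \<delta> / 2" for w
  proof -
    have C: "C w \<ge> 0" using B w by (auto simp: C_def abs_square_le_1)
    have pw: "poisson_kernel w \<zeta> * norm (f \<zeta> - f z0) \<le> \<epsilon> / 2 * poisson_kernel w \<zeta> + C w"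
      if \<zeta>: "cmod \<zeta> = 1" for \<zeta>
    proof (cases "dist \<zeta> z0 < \<delta>")
      case True
      hence "norm (f \<zeta> - f z0) \<le> \<epsilon> / 2"
        using \<delta>(2)[OF \<zeta>] by (auto simp: dist_norm)
      hence "poisson_kernel w \<zeta> * norm (f \<zeta> - f z0) \<le> poisson_kernel w \<zeta> * (\<epsilon> / 2)"
        using poisson_kernel_nonneg[OF w(1)] by (intro mult_left_mono) auto
      thus ?thesis using C by (simp add: mult.commute)
    next
      case False
      have "\<delta> / 2 \<le> cmod (\<zeta> - w)"
        using False w(2) dist_triangle[of \<zeta> z0 w] by (simp add: dist_norm)
      hence "poisson_kernel w \<zeta> \<le> (1 - (cmod w)\<^sup>2) / (\<delta> / 2)\<^sup>2"
        unfolding poisson_kernel_def using \<delta> w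
        by (intro divide_left_mono power_mono mult_pos_pos) (auto simp: abs_square_le_1)
      moreover have "norm (f \<zeta> - f z0) \<le> 2 * B"
        using norm_triangle_ineq4[of "f \<zeta>" "f z0"] B(2)[OF \<zeta>] B(2)[OF z0] by simp
      ultimately have "poisson_kernel w \<zeta> * norm (f \<zeta> - f z0) \<le> ((1 - (cmod w)\<^sup>2) / (\<delta> / 2)\<^sup>2) * (2 * B)"
        using poisson_kernel_nonneg[OF w(1), of \<zeta>] by (intro mult_mono) auto
      moreover have "0 \<le> \<epsilon> / 2 * poisson_kernel w \<zeta>"
        using \<epsilon> poisson_kernel_nonneg[OF w(1)] by simp
      ultimately show ?thesis by (simp add: C_def mult.commute)
    qed
    have int: "integrable arc_measure (\<lambda>\<zeta>. poisson_kernel w \<zeta> *\<^sub>R f \<zeta>)"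
      using fm B by (intro integrable_poisson[where B=B] w) auto
    have "poisson f w - f z0 = poisson (\<lambda>\<zeta>. f \<zeta> - f z0) w"
      using int integrable_poisson_kernel[OF w(1)]
      by (simp add: poisson_eq scaleR_diff_right poisson_kernel_integral[OF w(1)])
    hence "dist (poisson f w) (f z0) \<le> poisson (\<lambda>\<zeta>. norm (f \<zeta> - f z0)) w"
      using norm_poisson_le_poisson_norm[OF w(1), of "\<lambda>\<zeta>. f \<zeta> - f z0"] by (simp add: dist_norm)
    also have "\<dots> \<le> (LINT \<zeta>|arc_measure. \<epsilon> / 2 * poisson_kernel w \<zeta> + C w)"
      unfolding poisson_eq
    proof (rule integral_mono)
      show "integrable arc_measure (\<lambda>\<zeta>. poisson_kernel w \<zeta> *\<^sub>R norm (f \<zeta> - f z0))"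
      proof (rule integrable_poisson[where B="2*B"])
        have "norm (f \<zeta> - f z0) \<le> 2 * B" if "cmod \<zeta> = 1" for \<zeta>
          using norm_triangle_ineq4[of "f \<zeta>" "f z0"] B(2)[OF that] B(2)[OF z0] by simp
        thus "AE \<zeta> in arc_measure. norm (norm (f \<zeta> - f z0)) \<le> 2 * B"
          by (intro AE_I2) simp
      qed (use fm w in auto)
    qed (use pw integrable_poisson_kernel[OF w(1)] in auto)
    also have "\<dots> = \<epsilon> / 2 + C w"
      using integrable_poisson_kernel[OF w(1)]
      by (simp add: poisson_kernel_integral[OF w(1)] arc.prob_space[simplified])
    finally show ?thesis .
  qed
  have "(C \<longlongrightarrow> 2 * B * ((1 - (cmod z0)\<^sup>2) / (\<delta> / 2)\<^sup>2)) (at z0 within ball 0 1)"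
    unfolding C_def using \<delta>(1) by (intro tendsto_intros) auto
  hence "(C \<longlongrightarrow> 0) (at z0 within ball 0 1)" using z0 by simp
  hence "\<forall>\<^sub>F w in at z0 within ball 0 1. C w < \<epsilon> / 2"
    using \<epsilon> by (intro order_tendstoD(2)[of C 0]) auto
  moreover have "\<forall>\<^sub>F w in at z0 within ball 0 1. cmod w < 1 \<and> dist w z0 < \<delta> / 2"
    unfolding eventually_at using \<delta>(1) by (intro exI[of _ "\<delta>/2"]) auto
  ultimately show "\<forall>\<^sub>F w in at z0 within ball 0 1. dist (poisson f w) (f z0) < \<epsilon>"
  proof eventually_elim
    case (elim w)
    with main[of w] show ?case by auto
  qed
qed

text \<open>The harmonic extension of a boundary function. Unlike \<open>closed_disk_ext\<close> it is also defined for
  real-valued functions, since it is needed for $|F|^2$.\<close>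

definition poisson_ext :: "(complex \<Rightarrow> 'a::{banach, second_countable_topology}) \<Rightarrow> complex \<Rightarrow> 'a" where
  "poisson_ext f z = (if z \<in> ball 0 1 then poisson f z else f z)"

lemma closed_disk_ext_eq: "closed_disk_ext = poisson_ext"
  by (intro ext) (simp add: closed_disk_ext_def poisson_ext_def)

lemma poisson_ext_ball: "cmod z < 1 \<Longrightarrow> poisson_ext f z = poisson f z"
  and poisson_ext_circle: "cmod z = 1 \<Longrightarrow> poisson_ext f z = f z"
  by (auto simp: poisson_ext_def)

theorem continuous_on_poisson_ext:
  fixes f :: "complex \<Rightarrow> 'a::{banach, second_countable_topology}"
  assumes f: "continuous_on (sphere 0 1) f"
  shows "continuous_on (cball 0 1) (poisson_ext f)"
  unfolding continuous_on_def
proof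
  obtain B where B: "\<And>\<zeta>. cmod \<zeta> = 1 \<Longrightarrow> norm (f \<zeta>) \<le> B"
    using continuous_on_circle_bounded[OF f] by blast
  have cont: "continuous_on (ball 0 1) (poisson f)"
    using B by (intro continuous_on_poisson[where B=B] borel_measurable_continuous_on_circle f) auto
  fix z :: complex assume "z \<in> cball 0 1"
  then consider "cmod z < 1" | "cmod z = 1" by fastforce
  thus "(poisson_ext f \<longlongrightarrow> poisson_ext f z) (at z within cball 0 1)"
  proof cases
    case 1
    have "(poisson f \<longlongrightarrow> poisson_ext f z) (at z)"
      using cont 1 by (auto simp: continuous_on_eq_continuous_at isCont_def poisson_ext_def)
    hence "(poisson_ext f \<longlongrightarrow> poisson_ext f z) (at z)"
      by (rule Lim_transform_within_open[where s="ball 0 1"]) (use 1 in \<open>auto simp: poisson_ext_def\<close>)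
    thus ?thesis by (rule tendsto_within_subset) auto
  next
    case 2
    have "(poisson_ext f \<longlongrightarrow> f z) (at z within ball 0 1)"
      by (rule Lim_transform_eventually[OF tendsto_poisson_boundary[OF f 2]])
         (auto simp: eventually_at_filter poisson_ext_def)
    moreover have "(poisson_ext f \<longlongrightarrow> f z) (at z within sphere 0 1)"
    proof (rule Lim_transform_eventually)
      show "(f \<longlongrightarrow> f z) (at z within sphere 0 1)"
        using f 2 by (auto simp: continuous_on_def)
    qed (auto simp: eventually_at_filter poisson_ext_def)
    moreover have "cball 0 1 = ball 0 1 \<union> sphere (0::complex) 1" by auto
    ultimately show ?thesis
      using 2 by (simp add: Lim_within_Un poisson_ext_circle)
  qed
qed

text \<open>No nonempty open arc is a null set: a continuous function is recovered from its Poisson integral,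
  which only depends on its class modulo null functions.\<close>

lemma continuous_on_circle_AE_eq:
  fixes f g :: "complex \<Rightarrow> 'a::{banach, second_countable_topology}"
  assumes f: "continuous_on (sphere 0 1) f" and g: "continuous_on (sphere 0 1) g"
    and eq: "AE \<zeta> in arc_measure. f \<zeta> = g \<zeta>" and z: "cmod z = 1"
  shows "f z = g z"
proof -
  have "poisson f = poisson g"
    using eq by (intro ext poisson_cong_AE borel_measurable_continuous_on_circle f g)
  hence "(poisson f \<longlongrightarrow> g z) (at z within ball 0 1)"
    using tendsto_poisson_boundary[OF g z] by simp
  moreover have "at z within ball 0 1 \<noteq> bot"
    using z by (simp add: trivial_limit_within islimpt_ball)
  ultimately show ?thesis
    using tendsto_unique tendsto_poisson_boundary[OF f z] by blast
qed

text \<open>Replacing $f$ by $\max(f,c)$ turns the inequality into an equality almost everywhere.\<close>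

lemma continuous_on_circle_AE_le:
  fixes f :: "complex \<Rightarrow> real"
  assumes f: "continuous_on (sphere 0 1) f"
    and le: "AE \<zeta> in arc_measure. f \<zeta> \<le> c" and z: "cmod z = 1"
  shows "f z \<le> c"
proof -
  have "max (f z) c = c"
    using le by (intro continuous_on_circle_AE_eq[where f="\<lambda>\<zeta>. max (f \<zeta>) c" and g="\<lambda>_. c"] z)
      (auto intro!: continuous_on_max continuous_on_const f elim: eventually_mono)
  thus ?thesis by simp
qed

section \<open>Multiplicativity of the Poisson integral\<close>

interpretation arc2: pair_prob_space arc_measure arc_measure ..

text \<open>By the symmetry of the kernel, the operator taking $f$ to
  $\zeta\mapsto\mathcal Pf(r\zeta)$ on the circle is symmetric for the bilinear pairing $\int fh\,dm$.\<close>

lemma poisson_dilation_adjoint: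
  fixes f h :: "complex \<Rightarrow> complex"
  assumes f: "f \<in> borel_measurable arc_measure" "AE \<zeta> in arc_measure. norm (f \<zeta>) \<le> A"
    and h: "h \<in> borel_measurable arc_measure" "AE \<zeta> in arc_measure. norm (h \<zeta>) \<le> B"
    and r: "0 \<le> r" "r < 1"
  shows "(LINT \<xi>|arc_measure. f \<xi> * poisson h (of_real r * \<xi>)) =
         (LINT \<zeta>|arc_measure. poisson f (of_real r * \<zeta>) * h \<zeta>)"
proof -
  note [measurable] = f(1) h(1)
  define k where "k \<xi> \<zeta> = poisson_kernel (of_real r * \<xi>) \<zeta> *\<^sub>R (f \<xi> * h \<zeta>)" for \<xi> \<zeta>
  have km: "(\<lambda>(\<xi>, \<zeta>). k \<xi> \<zeta>) \<in> borel_measurable (arc_measure \<Otimes>\<^sub>M arc_measure)"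
    unfolding k_def poisson_kernel_def by measurable
  have bound: "norm (k \<xi> \<zeta>) \<le> 1 / (1 - r)\<^sup>2 * (A * B)"
    if "cmod \<xi> = 1" "cmod \<zeta> = 1" "norm (f \<xi>) \<le> A" "norm (h \<zeta>) \<le> B" for \<xi> \<zeta>
  proof -
    have "A \<ge> 0" using that(3) norm_ge_zero order_trans by blast
    hence "norm (f \<xi> * h \<zeta>) \<le> A * B"
      unfolding norm_mult using that by (intro mult_mono) auto
    thus ?thesis
      unfolding k_def using that r by (intro norm_poisson_kernel_scaleR_le) (auto simp: norm_mult)
  qed
  have "integrable (arc_measure \<Otimes>\<^sub>M arc_measure) (\<lambda>(\<xi>, \<zeta>). k \<xi> \<zeta>)"
  proof (rule arc2.integrable_const_bound[OF _ km])
    show "AE x in arc_measure \<Otimes>\<^sub>M arc_measure.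
            norm (case x of (\<xi>, \<zeta>) \<Rightarrow> k \<xi> \<zeta>) \<le> 1 / (1 - r)\<^sup>2 * (A * B)"
    proof (rule arc2.AE_pair_measure)
      show "{x \<in> space (arc_measure \<Otimes>\<^sub>M arc_measure).
               norm (case x of (\<xi>, \<zeta>) \<Rightarrow> k \<xi> \<zeta>) \<le> 1 / (1 - r)\<^sup>2 * (A * B)}
            \<in> sets (arc_measure \<Otimes>\<^sub>M arc_measure)"
        using km by measurable
      show "AE \<xi> in arc_measure. AE \<zeta> in arc_measure.
              norm (case (\<xi>, \<zeta>) of (\<xi>, \<zeta>) \<Rightarrow> k \<xi> \<zeta>) \<le> 1 / (1 - r)\<^sup>2 * (A * B)"
        using f(2) AE_space
      proof eventually_elim
        case (elim \<xi>)
        from h(2) AE_space show ?case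
          by eventually_elim (use elim bound in auto)
      qed
    qed
  qed
  hence "(LINT \<zeta>|arc_measure. LINT \<xi>|arc_measure. k \<xi> \<zeta>) =
         (LINT \<xi>|arc_measure. LINT \<zeta>|arc_measure. k \<xi> \<zeta>)"
    by (rule arc2.Fubini_integral)
  moreover have "(LINT \<zeta>|arc_measure. k \<xi> \<zeta>) = f \<xi> * poisson h (of_real r * \<xi>)" for \<xi>
    unfolding k_def poisson_eq by (subst integral_mult_right_zero[symmetric]) (simp add: mult_ac)
  moreover have "(LINT \<zeta>|arc_measure. LINT \<xi>|arc_measure. k \<xi> \<zeta>) =
      (LINT \<zeta>|arc_measure. poisson f (of_real r * \<zeta>) * h \<zeta>)"
    unfolding k_def poisson_eq integral_mult_left_zero[symmetric]
    by (intro Bochner_Integration.integral_cong refl) (auto simp: poisson_kernel_symmetric)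
  ultimately show ?thesis by simp
qed

text \<open>Let $h(\zeta)=P_z(\zeta)g(\zeta)$, where $P_z$ is the Poisson kernel at $z$. Since $h$ is continuous,
  $\int f(\zeta)\,\mathcal Ph(r\zeta)\,dm$ tends to $\int fh\,dm=\mathcal P(fg)(z)$ as $r\to 1$.
  By symmetry it equals $\int\mathcal Pf(r\zeta)h(\zeta)\,dm$, the Poisson integral at $z$ of
  $\mathcal Pf(r\,\cdot)\,g$, which is analytic in the disk and continuous up to the boundary; so it has
  the value $\mathcal Pf(rz)\,g(z)$. No boundary limits of $\mathcal Pf$ are involved.\<close>

theorem poisson_mult_holomorphic:
  fixes f g :: "complex \<Rightarrow> complex"
  assumes f: "f \<in> borel_measurable arc_measure" "AE \<zeta> in arc_measure. norm (f \<zeta>) \<le> A"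
    and f_hol: "poisson f holomorphic_on ball 0 1"
    and g: "continuous_on (cball 0 1) g" "g holomorphic_on ball 0 1" and z: "cmod z < 1"
  shows "poisson (\<lambda>\<zeta>. f \<zeta> * g \<zeta>) z = poisson f z * g z"
proof -
  define h where "h \<zeta> = poisson_kernel z \<zeta> *\<^sub>R g \<zeta>" for \<zeta>
  define r where "r n = real n / real (Suc n)" for n
  have r: "0 \<le> r n" "r n < 1" for n by (auto simp: r_def)
  have r_lim: "r \<longlonglongrightarrow> 1" unfolding r_def by (rule LIMSEQ_n_over_Suc_n)
  have h_cont: "continuous_on (sphere 0 1) h"
    unfolding h_def
    by (intro continuous_intros continuous_on_poisson_kernel z continuous_on_subset[OF g(1)]) auto
  obtain B where B: "0 \<le> B" "\<And>\<zeta>. cmod \<zeta> = 1 \<Longrightarrow> norm (h \<zeta>) \<le> B"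
    using continuous_on_circle_bounded[OF h_cont] by blast
  have hm [measurable]: "h \<in> borel_measurable arc_measure"
    using h_cont by (rule borel_measurable_continuous_on_circle)
  note [measurable] = f(1)
  have dil_in: "of_real (r n) * \<xi> \<in> ball 0 1" if "cmod \<xi> \<le> 1" for n and \<xi> :: complex
  proof -
    have "r n * cmod \<xi> \<le> r n * 1" using that r(1)[of n] by (intro mult_left_mono) auto
    also have "\<dots> < 1" using r by simp
    finally show ?thesis using r(1)[of n] by (simp add: norm_mult)
  qed
  have dil_lim: "(\<lambda>n. of_real (r n) * \<xi>) \<longlonglongrightarrow> \<xi>" for \<xi> :: complex
    using tendsto_mult[OF tendsto_of_real[OF r_lim] tendsto_const[of \<xi>]] by simp
  have dil_cont: "continuous_on (cball 0 1) (\<lambda>\<xi>. poisson u (of_real (r n) * \<xi>))"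
    if "continuous_on (ball 0 1) (poisson u)" for u :: "complex \<Rightarrow> complex" and n
    by (rule continuous_on_compose2[OF that]) (use dil_in in \<open>auto intro!: continuous_intros\<close>)
  have Ph_cont: "continuous_on (ball 0 1) (poisson h)"
    using B by (intro continuous_on_poisson[where B=B] hm) auto
  have Pf_cont: "continuous_on (ball 0 1) (poisson f)"
    using f_hol by (rule holomorphic_on_imp_continuous_on)
  have "(\<lambda>n. LINT \<xi>|arc_measure. f \<xi> * poisson h (of_real (r n) * \<xi>)) \<longlonglongrightarrow>
        (LINT \<xi>|arc_measure. f \<xi> * h \<xi>)"
  proof (rule integral_dominated_convergence)
    show "AE \<xi> in arc_measure. (\<lambda>n. f \<xi> * poisson h (of_real (r n) * \<xi>)) \<longlonglongrightarrow> f \<xi> * h \<xi>"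
      using AE_space
    proof eventually_elim
      case (elim \<xi>)
      hence \<xi>: "cmod \<xi> = 1" by simp
      have "(\<lambda>n. poisson_ext h (of_real (r n) * \<xi>)) \<longlonglongrightarrow> poisson_ext h \<xi>"
        using \<xi> dil_in[of \<xi>]
        by (intro continuous_on_tendsto_compose[OF continuous_on_poisson_ext[OF h_cont] dil_lim]
              always_eventually allI) (auto intro: less_imp_le)
      thus ?case
        using \<xi> dil_in[of \<xi>] by (intro tendsto_intros) (simp add: poisson_ext_def)
    qed
    show "AE \<xi> in arc_measure. norm (f \<xi> * poisson h (of_real (r n) * \<xi>)) \<le> A * B" for n
      using f(2) AE_space
    proof eventually_elim
      case (elim \<xi>)
      have "0 \<le> A" using elim(1) norm_ge_zero order_trans by blast
      moreover have "norm (poisson h (of_real (r n) * \<xi>)) \<le> B"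
        using dil_in[of \<xi> n] elim(2) B by (intro norm_poisson_le hm) auto
      ultimately show ?case
        unfolding norm_mult using elim by (intro mult_mono) auto
    qed
    show "(\<lambda>\<xi>. f \<xi> * poisson h (of_real (r n) * \<xi>)) \<in> borel_measurable arc_measure" for n
      by (intro borel_measurable_times f(1) borel_measurable_continuous_on_circle
            continuous_on_subset[OF dil_cont[OF Ph_cont]]) auto
  qed auto
  moreover have "(LINT \<xi>|arc_measure. f \<xi> * h \<xi>) = poisson (\<lambda>\<zeta>. f \<zeta> * g \<zeta>) z"
    by (simp add: poisson_eq h_def)
  moreover have "(LINT \<xi>|arc_measure. f \<xi> * poisson h (of_real (r n) * \<xi>)) =
      poisson f (of_real (r n) * z) * g z" for n
  proof -
    have "(LINT \<xi>|arc_measure. f \<xi> * poisson h (of_real (r n) * \<xi>)) =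
        (LINT \<zeta>|arc_measure. poisson f (of_real (r n) * \<zeta>) * h \<zeta>)"
      using B by (intro poisson_dilation_adjoint[where A=A and B=B] f hm r) auto
    also have "\<dots> = poisson (\<lambda>\<zeta>. poisson f (of_real (r n) * \<zeta>) * g \<zeta>) z"
      by (simp add: poisson_eq h_def)
    also have "\<dots> = poisson f (of_real (r n) * z) * g z"
    proof (rule poisson_holomorphic)
      have "(\<lambda>\<zeta>. poisson f (of_real (r n) * \<zeta>)) holomorphic_on ball 0 1"
        using holomorphic_on_compose_gen[OF _ f_hol, of "\<lambda>\<zeta>. of_real (r n) * \<zeta>" "ball 0 1"] dil_in
        by (force simp: o_def intro!: holomorphic_intros)
      thus "(\<lambda>\<zeta>. poisson f (of_real (r n) * \<zeta>) * g \<zeta>) holomorphic_on ball 0 1"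
        by (intro holomorphic_intros g)
      show "continuous_on (cball 0 1) (\<lambda>\<zeta>. poisson f (of_real (r n) * \<zeta>) * g \<zeta>)"
        by (intro continuous_intros dil_cont Pf_cont g)
    qed (rule z)
    finally show ?thesis .
  qed
  moreover have "(\<lambda>n. poisson f (of_real (r n) * z) * g z) \<longlonglongrightarrow> poisson f z * g z"
    using z dil_in[of z]
    by (intro tendsto_mult_right continuous_on_tendsto_compose[OF Pf_cont dil_lim]
          always_eventually allI) auto
  ultimately show ?thesis
    using LIMSEQ_unique by auto
qed


section \<open>Norms and the Garsia function\<close>

lemma sup_norm_le_iff:
  assumes "f \<in> borel_measurable arc_measure"
  shows "sup_norm f \<le> ereal B \<longleftrightarrow> (AE \<zeta> in arc_measure. cmod (f \<zeta>) \<le> B)"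
proof
  assume le: "sup_norm f \<le> ereal B"
  have "AE \<zeta> in arc_measure. ereal (cmod (f \<zeta>)) \<le> sup_norm f"
    unfolding sup_norm_def by (rule esssup_AE)
  thus "AE \<zeta> in arc_measure. cmod (f \<zeta>) \<le> B"
    by eventually_elim (use le in \<open>auto dest: order_trans\<close>)
next
  assume "AE \<zeta> in arc_measure. cmod (f \<zeta>) \<le> B"
  thus "sup_norm f \<le> ereal B"
    unfolding sup_norm_def using assms by (intro esssup_I) auto
qed

lemma L_infinity_bounded:
  assumes "f \<in> L_infinity"
  obtains B where "f \<in> borel_measurable arc_measure" "AE \<zeta> in arc_measure. cmod (f \<zeta>) \<le> B"
proof -
  have f: "f \<in> borel_measurable arc_measure" "sup_norm f < \<infinity>"
    using assms by (auto simp: L_infinity_def)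
  obtain B where "sup_norm f \<le> ereal B"
    using f(2) by (cases "sup_norm f") auto
  with f(1) that show ?thesis by (simp add: sup_norm_le_iff)
qed

lemma sup_norm_continuous:
  assumes f: "continuous_on (sphere 0 1) f"
  obtains M where "sup_norm f = ereal M" "\<And>\<zeta>. cmod \<zeta> = 1 \<Longrightarrow> cmod (f \<zeta>) \<le> M"
proof -
  have fm: "f \<in> borel_measurable arc_measure"
    using f by (rule borel_measurable_continuous_on_circle)
  have le: "cmod (f \<zeta>) \<le> c" if "sup_norm f \<le> ereal c" "cmod \<zeta> = 1" for c \<zeta>
    using that unfolding sup_norm_le_iff[OF fm]
    by (intro continuous_on_circle_AE_le[where f="\<lambda>\<zeta>. cmod (f \<zeta>)"]) (auto intro!: continuous_intros f)
  obtain B where B: "\<And>\<zeta>. cmod \<zeta> = 1 \<Longrightarrow> norm (f \<zeta>) \<le> B"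
    using continuous_on_circle_bounded[OF f] by blast
  have "AE \<zeta> in arc_measure. cmod (f \<zeta>) \<le> B"
    by (rule AE_I2) (simp add: B)
  hence "sup_norm f \<le> ereal B"
    unfolding sup_norm_le_iff[OF fm] .
  moreover have "sup_norm f \<noteq> - \<infinity>"
    using le[of "-1" 1] norm_ge_zero[of "f 1"] by auto
  ultimately obtain M where M: "sup_norm f = ereal M"
    by (cases "sup_norm f") auto
  show ?thesis
    by (rule that[OF M]) (rule le, simp_all add: M)
qed

text \<open>The variance of $f$ with respect to the probability measure with density \<open>poisson_kernel z\<close>
  is nonnegative.\<close>

lemma garsia_Phi_nonneg:
  assumes f: "f \<in> borel_measurable arc_measure" "AE \<zeta> in arc_measure. cmod (f \<zeta>) \<le> B"
    and z: "cmod z < 1"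
  shows "0 \<le> garsia_Phi f z"
proof -
  define a where "a = poisson f z"
  let ?k = "poisson_kernel z"
  have "AE \<zeta> in arc_measure. norm ((cmod (f \<zeta>))\<^sup>2) \<le> B\<^sup>2"
    using f(2) by eventually_elim (auto intro: power_mono)
  hence int2: "integrable arc_measure (\<lambda>\<zeta>. ?k \<zeta> * (cmod (f \<zeta>))\<^sup>2)"
    using integrable_poisson[of "\<lambda>\<zeta>. (cmod (f \<zeta>))\<^sup>2" "B\<^sup>2" z] f z by simp
  have inta: "integrable arc_measure (\<lambda>\<zeta>. a \<bullet> (?k \<zeta> *\<^sub>R f \<zeta>))"
    by (intro integrable_inner_right integrable_poisson[OF f z])
  have a: "(LINT \<zeta>|arc_measure. a \<bullet> (?k \<zeta> *\<^sub>R f \<zeta>)) = a \<bullet> a"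
    unfolding a_def poisson_eq by (intro integral_inner_right integrable_poisson[OF f z])
  have "0 \<le> (LINT \<zeta>|arc_measure. ?k \<zeta> * (cmod (f \<zeta> - a))\<^sup>2)"
    using poisson_kernel_nonneg[OF z] by (intro integral_nonneg_AE) auto
  also have "\<dots> = (LINT \<zeta>|arc_measure. ?k \<zeta> * (cmod (f \<zeta>))\<^sup>2 + ?k \<zeta> * (cmod a)\<^sup>2 - 2 * (a \<bullet> (?k \<zeta> *\<^sub>R f \<zeta>)))"
    by (intro Bochner_Integration.integral_cong refl)
       (simp add: power2_norm_eq_inner inner_diff_left inner_diff_right inner_commute algebra_simps)
  also have "\<dots> = poisson (\<lambda>\<zeta>. (cmod (f \<zeta>))\<^sup>2) z + (cmod a)\<^sup>2 - 2 * (a \<bullet> a)"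
    unfolding a[symmetric] using int2 inta integrable_poisson_kernel[OF z]
    by (simp add: poisson_eq[of "\<lambda>\<zeta>. (cmod (f \<zeta>))\<^sup>2"] poisson_kernel_integral[OF z])
  also have "\<dots> = garsia_Phi f z"
    by (simp add: garsia_Phi_def a_def power2_norm_eq_inner)
  finally show ?thesis .
qed

lemma poisson_norm_square_le:
  assumes f: "f \<in> borel_measurable arc_measure" "AE \<zeta> in arc_measure. cmod (f \<zeta>) \<le> B"
    and z: "cmod z < 1"
  shows "poisson (\<lambda>\<zeta>. (cmod (f \<zeta>))\<^sup>2) z \<le> B\<^sup>2"
proof -
  have "norm (poisson (\<lambda>\<zeta>. (cmod (f \<zeta>))\<^sup>2) z) \<le> B\<^sup>2"
    using f by (intro norm_poisson_le z) (auto intro: power_mono elim!: eventually_mono)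
  thus ?thesis by simp
qed

section \<open>Functions in the disk algebra and inner functions\<close>

lemma disk_algebraD:
  assumes "F \<in> disk_algebra"
  shows "continuous_on (sphere 0 1) F" "F \<in> borel_measurable arc_measure"
    "continuous_on (cball 0 1) (poisson_ext F)" "poisson_ext F holomorphic_on ball 0 1"
proof -
  show F: "continuous_on (sphere 0 1) F"
    using assms by (simp add: disk_algebra_def)
  show "F \<in> borel_measurable arc_measure"
    using F by (rule borel_measurable_continuous_on_circle)
  show "continuous_on (cball 0 1) (poisson_ext F)"
    using F by (rule continuous_on_poisson_ext)
  have "poisson F holomorphic_on ball 0 1"
    using assms by (auto simp: disk_algebra_def H_infinity_def intro: analytic_imp_holomorphic)
  thus "poisson_ext F holomorphic_on ball 0 1"
    by (rule holomorphic_transform) (simp add: poisson_ext_def)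
qed

lemma inner_functionD:
  assumes "inner_function I"
  shows "I \<in> borel_measurable arc_measure" "AE \<zeta> in arc_measure. cmod (I \<zeta>) = 1"
    "AE \<zeta> in arc_measure. cmod (I \<zeta>) \<le> 1" "poisson I holomorphic_on ball 0 1"
  using assms
  by (auto simp: inner_function_def H_infinity_def L_infinity_def
        intro: analytic_imp_holomorphic elim: eventually_mono)

text \<open>In $\Phi_{IF}$ the factor $I$ disappears from the first term and splits off from the second.\<close>

lemma garsia_Phi_inner_mult:
  assumes F: "F \<in> disk_algebra" and I: "inner_function I" and z: "cmod z < 1"
  shows "garsia_Phi (\<lambda>\<zeta>. I \<zeta> * F \<zeta>) z =
    poisson (\<lambda>\<zeta>. (cmod (F \<zeta>))\<^sup>2) z - (cmod (poisson I z) * cmod (poisson F z))\<^sup>2"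
proof -
  note [measurable] = disk_algebraD(2)[OF F] inner_functionD(1)[OF I]
  have "poisson (\<lambda>\<zeta>. (cmod (I \<zeta> * F \<zeta>))\<^sup>2) z = poisson (\<lambda>\<zeta>. (cmod (F \<zeta>))\<^sup>2) z"
    using inner_functionD(2)[OF I]
    by (intro poisson_cong_AE) (auto simp: norm_mult elim: eventually_mono)
  moreover have "poisson (\<lambda>\<zeta>. I \<zeta> * F \<zeta>) z = poisson (\<lambda>\<zeta>. I \<zeta> * poisson_ext F \<zeta>) z"
    by (intro poisson_cong) (simp add: poisson_ext_circle)
  moreover have "\<dots> = poisson I z * poisson F z"
    using poisson_mult_holomorphic[OF inner_functionD(1,3,4)[OF I] disk_algebraD(3,4)[OF F] z] z
    by (simp add: poisson_ext_ball)
  ultimately show ?thesis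
    by (simp add: garsia_Phi_def norm_mult)
qed

lemma sup_norm_inner_mult:
  assumes F: "F \<in> borel_measurable arc_measure" and I: "inner_function I"
  shows "sup_norm (\<lambda>\<zeta>. I \<zeta> * F \<zeta>) = sup_norm F"
  unfolding sup_norm_def using inner_functionD(2)[OF I] F inner_functionD(1)[OF I]
  by (intro esssup_AE_cong) (auto simp: norm_mult elim: eventually_mono)

lemma at_within_disk_neq_bot: "z \<in> cball 0 1 \<Longrightarrow> at z within ball (0::complex) 1 \<noteq> bot"
  by (simp add: trivial_limit_within islimpt_ball)

lemma spectrum_innerD:
  assumes "z \<in> spectrum_inner I" "\<epsilon> > 0" "\<forall>\<^sub>F w in at z within ball 0 1. P w"
  obtains w where "cmod w < 1" "cmod (poisson I w) < \<epsilon>" "P w"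
proof (rule ccontr)
  assume "\<not> thesis"
  hence *: "\<not> (cmod w < 1 \<and> cmod (poisson I w) < \<epsilon> \<and> P w)" for w
    using that by blast
  have "\<forall>\<^sub>F w in at z within ball 0 1. w \<in> ball 0 1"
    by (simp add: eventually_at_filter)
  with assms(3) have "\<forall>\<^sub>F w in at z within ball 0 1. ereal \<epsilon> \<le> ereal (cmod (poisson I w))"
  proof eventually_elim
    case (elim w)
    with *[of w] show ?case by auto
  qed
  hence "ereal \<epsilon> \<le> Liminf (at z within ball 0 1) (\<lambda>w. ereal (cmod (poisson I w)))"
    by (rule Liminf_bounded)
  with assms(1,2) show False by (simp add: spectrum_inner_def)
qed

text \<open>The lower limit in \<open>spectrum_inner\<close> is taken over a punctured neighbourhood. At a point of the
  circle this makes no difference; at a point of the open disk continuity of \<open>poisson I\<close> is used.\<close>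

lemma spectrum_innerI:
  assumes cont: "continuous_on (ball 0 1) (poisson I)"
    and x: "\<And>n. cmod (x n) < 1" "x \<longlonglongrightarrow> z" and lim: "(\<lambda>n. poisson I (x n)) \<longlonglongrightarrow> 0"
  shows "z \<in> spectrum_inner I"
proof -
  let ?L = "Liminf (at z within ball 0 1) (\<lambda>w. ereal (cmod (poisson I w)))"
  have z: "z \<in> cball 0 1"
    by (rule Lim_in_closed_set[OF closed_cball _ _ x(2)])
       (use x(1) in \<open>auto intro!: always_eventually less_imp_le\<close>)
  have "?L = 0"
  proof (cases "cmod z < 1")
    case True
    have "(\<lambda>n. poisson I (x n)) \<longlonglongrightarrow> poisson I z"
      using True x by (intro continuous_on_tendsto_compose[OF cont]) auto
    hence "poisson I z = 0"
      using lim LIMSEQ_unique by blast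
    moreover have "(poisson I \<longlongrightarrow> poisson I z) (at z within ball 0 1)"
      using cont True by (auto simp: continuous_on_def)
    ultimately have "((\<lambda>w. cmod (poisson I w)) \<longlongrightarrow> 0) (at z within ball 0 1)"
      by (simp add: tendsto_norm_zero_iff)
    hence "((\<lambda>w. ereal (cmod (poisson I w))) \<longlongrightarrow> 0) (at z within ball 0 1)"
      by (simp add: zero_ereal_def)
    thus ?thesis
      by (rule lim_imp_Liminf[OF at_within_disk_neq_bot[OF z]])
  next
    case False
    have "\<not> 0 < ?L"
    proof
      assume "0 < ?L"
      then obtain e where e: "0 < e" "e < ?L" using dense by blast
      hence "\<forall>\<^sub>F w in at z within ball 0 1. e < ereal (cmod (poisson I w))"
        using le_Liminf_iff[THEN iffD1, OF order_refl] by blast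
      moreover have "filterlim x (at z within ball 0 1) sequentially"
        using x False by (auto simp: filterlim_at intro!: always_eventually)
      ultimately have "\<forall>\<^sub>F n in sequentially. e < ereal (cmod (poisson I (x n)))"
        by (rule eventually_compose_filterlim)
      moreover have "(\<lambda>n. ereal (cmod (poisson I (x n)))) \<longlonglongrightarrow> 0"
        using tendsto_norm_zero[OF lim] by (simp add: zero_ereal_def)
      hence "\<forall>\<^sub>F n in sequentially. ereal (cmod (poisson I (x n))) < e"
        using e(1) by (rule order_tendstoD(2))
      ultimately have "\<forall>\<^sub>F n :: nat in sequentially. False"
        by eventually_elim simp
      thus False by simp
    qed
    moreover have "0 \<le> ?L"
      by (intro Liminf_bounded always_eventually) auto
    ultimately show ?thesis by simp
  qed
  with z show ?thesis by (simp add: spectrum_inner_def)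
qed

text \<open>If $\mathcal P(|F|^2)$ attains the upper bound $M^2$ at an interior point, then $|F|=M$ on the
  circle, since the kernel is positive. Then $F$ has no zeros in the closed disk, so the maximum principle
  applies to $1/F$ and yields $|F|\ge M$ in the disk.\<close>

lemma cmod_poisson_ext_eq_max:
  assumes F: "F \<in> disk_algebra" and nz: "\<And>z. cmod z < 1 \<Longrightarrow> poisson F z \<noteq> 0"
    and M: "0 < M" "\<And>\<zeta>. cmod \<zeta> = 1 \<Longrightarrow> cmod (F \<zeta>) \<le> M"
    and z: "cmod z \<le> 1" and eq: "poisson_ext (\<lambda>\<zeta>. (cmod (F \<zeta>))\<^sup>2) z = M\<^sup>2"
  shows "cmod (poisson_ext F z) = M"
proof (cases "cmod z < 1")
  case False
  with z eq have "cmod z = 1" "(cmod (F z))\<^sup>2 = M\<^sup>2"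
    by (auto simp: poisson_ext_circle)
  with M(1) show ?thesis
    by (simp add: poisson_ext_circle)
next
  case True
  note Fm [measurable] = disk_algebraD(2)[OF F]
  let ?k = "poisson_kernel z"
  have nonneg: "0 \<le> ?k \<zeta> * (M\<^sup>2 - (cmod (F \<zeta>))\<^sup>2)" if "cmod \<zeta> = 1" for \<zeta>
    using that poisson_kernel_nonneg[OF True] M by (auto intro!: mult_nonneg_nonneg power_mono)
  have bound: "AE \<zeta> in arc_measure. norm ((cmod (F \<zeta>))\<^sup>2) \<le> M\<^sup>2"
    using M by (intro AE_I2) (auto intro: power_mono)
  have int: "integrable arc_measure (\<lambda>\<zeta>. ?k \<zeta> * (cmod (F \<zeta>))\<^sup>2)"
    using integrable_poisson[OF _ bound True] by simp
  have "(LINT \<zeta>|arc_measure. ?k \<zeta> * (M\<^sup>2 - (cmod (F \<zeta>))\<^sup>2)) = 0"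
    using eq int integrable_poisson_kernel[OF True] True
    by (simp add: poisson_ext_ball poisson_eq right_diff_distrib poisson_kernel_integral)
  hence "AE \<zeta> in arc_measure. ?k \<zeta> * (M\<^sup>2 - (cmod (F \<zeta>))\<^sup>2) = 0"
    using int integrable_poisson_kernel[OF True] nonneg
    by (subst (asm) integral_nonneg_eq_0_iff_AE) (auto simp: right_diff_distrib)
  hence "AE \<zeta> in arc_measure. cmod (F \<zeta>) = M"
    using AE_space
  proof eventually_elim
    case (elim \<zeta>)
    with M(1) poisson_kernel_pos[OF True, of \<zeta>] show ?case
      by auto
  qed
  hence circle: "cmod (F \<zeta>) = M" if "cmod \<zeta> = 1" for \<zeta>
    using that
    by (intro continuous_on_circle_AE_eq[where f="\<lambda>\<zeta>. cmod (F \<zeta>)" and g="\<lambda>_. M"])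
       (auto intro!: continuous_intros disk_algebraD(1)[OF F])
  have nz': "poisson_ext F w \<noteq> 0" if "cmod w \<le> 1" for w
  proof (cases "cmod w < 1")
    case False
    with that circle[of w] M(1) show ?thesis by (auto simp: poisson_ext_circle)
  qed (use nz in \<open>auto simp: poisson_ext_ball\<close>)
  define g where "g w = 1 / poisson_ext F w" for w
  have g: "continuous_on (cball 0 1) g" "g holomorphic_on ball 0 1"
    unfolding g_def using nz' disk_algebraD(3,4)[OF F]
    by (auto intro!: continuous_intros holomorphic_intros)
  have "cmod (poisson g z) \<le> 1 / M"
  proof (rule norm_poisson_le)
    show "g \<in> borel_measurable arc_measure"
      using g(1) by (intro borel_measurable_continuous_on_circle continuous_on_subset[OF g(1)]) auto
    show "AE \<zeta> in arc_measure. cmod (g \<zeta>) \<le> 1 / M"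
      by (intro AE_I2) (simp add: g_def poisson_ext_circle norm_divide circle)
  qed (rule True)
  hence "1 / cmod (poisson F z) \<le> 1 / M"
    using poisson_holomorphic[OF g True] True by (simp add: g_def poisson_ext_ball norm_divide)
  hence "M \<le> cmod (poisson F z)"
    using M(1) nz[OF True] by (simp add: field_simps)
  moreover have "cmod (poisson F z) \<le> M"
    using M by (intro norm_poisson_le Fm True AE_I2) auto
  ultimately show ?thesis
    using True by (simp add: poisson_ext_ball)
qed

section \<open>Extremality\<close>

theorem corollary2p6:
  fixes F I :: "complex \<Rightarrow> complex"
  assumes "F \<in> disk_algebra" and "outer_on_disk (poisson F)"
    and "inner_function I"
  shows "G_extremal (\<lambda>\<zeta>. I \<zeta> * F \<zeta>) \<longleftrightarrow> max_modulus_set F \<inter> spectrum_inner I \<noteq> {}"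
proof -
  note F = assms(1) and I = assms(3)
  note Fm [measurable] = disk_algebraD(2)[OF F] and Im [measurable] = inner_functionD(1)[OF I]
  have nz: "poisson F z \<noteq> 0" if "cmod z < 1" for z
    using assms(2) that by (auto simp: outer_on_disk_def)
  obtain M where M: "sup_norm F = ereal M" "\<And>\<zeta>. cmod \<zeta> = 1 \<Longrightarrow> cmod (F \<zeta>) \<le> M"
    using sup_norm_continuous[OF disk_algebraD(1)[OF F]] by blast
  have FM: "AE \<zeta> in arc_measure. cmod (F \<zeta>) \<le> M"
    using M(2) by (intro AE_I2) simp
  have PF_le: "cmod (poisson F z) \<le> M" if "cmod z < 1" for z
    using Fm FM that by (rule norm_poisson_le)
  have M_pos: "0 < M"
    using PF_le[of 0] nz[of 0] by (metis norm_zero order_less_le_trans zero_less_norm_iff zero_less_one)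
  define f where "f \<zeta> = I \<zeta> * F \<zeta>" for \<zeta>
  define Q where "Q = poisson_ext (\<lambda>\<zeta>. (cmod (F \<zeta>))\<^sup>2)"
  have fm: "f \<in> borel_measurable arc_measure" unfolding f_def by measurable
  have f_sup: "sup_norm f = ereal M"
    unfolding f_def sup_norm_inner_mult[OF Fm I] by (rule M(1))
  hence fM: "AE \<zeta> in arc_measure. cmod (f \<zeta>) \<le> M"
    using sup_norm_le_iff[OF fm, of M] by simp
  have Q_cont: "continuous_on (cball 0 1) Q"
    unfolding Q_def by (intro continuous_on_poisson_ext continuous_intros disk_algebraD(1)[OF F])
  have Q_le: "Q z \<le> M\<^sup>2" if "cmod z < 1" for z
    using poisson_norm_square_le[OF Fm FM that] that by (simp add: Q_def poisson_ext_ball)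
  have Phi: "garsia_Phi f z = Q z - (cmod (poisson I z) * cmod (poisson F z))\<^sup>2" if "cmod z < 1" for z
    using garsia_Phi_inner_mult[OF F I that] that by (simp add: f_def[abs_def] Q_def poisson_ext_ball)
  have Phi_le: "garsia_Phi f z \<le> M\<^sup>2" if "cmod z < 1" for z
    using Q_le[OF that] Phi[OF that] by (smt (verit) zero_le_power2)
  have Phi_nonneg: "0 \<le> garsia_Phi f z" if "cmod z < 1" for z
    using fm fM that by (rule garsia_Phi_nonneg)
  have norm_le: "garsia_norm f \<le> ereal M"
    unfolding garsia_norm_def
  proof (rule SUP_least)
    fix z :: complex assume "z \<in> ball 0 1"
    with Phi_le[of z] M_pos show "ereal (sqrt (garsia_Phi f z)) \<le> ereal M"
      by (simp add: real_le_lsqrt)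
  qed
  have "G_extremal f \<longleftrightarrow> garsia_norm f = ereal M"
    using fm f_sup by (simp add: G_extremal_def L_infinity_def)
  also have "\<dots> \<longleftrightarrow> max_modulus_set F \<inter> spectrum_inner I \<noteq> {}"
  proof
    assume "max_modulus_set F \<inter> spectrum_inner I \<noteq> {}"
    then obtain z0 where z0: "cmod z0 \<le> 1" "cmod (poisson_ext F z0) = M" "z0 \<in> spectrum_inner I"
      by (auto simp: max_modulus_set_def closed_disk_ext_eq M(1))
    have Qz0: "M\<^sup>2 \<le> Q z0"
    proof (cases "cmod z0 < 1")
      case True
      with garsia_Phi_nonneg[OF Fm FM True] z0(2) show ?thesis
        by (simp add: garsia_Phi_def Q_def poisson_ext_ball)
    next
      case False
      with z0 show ?thesis by (simp add: Q_def poisson_ext_circle)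
    qed
    \<comment> \<open>Near \<open>z0\<close>, \<open>Q\<close> is almost at least \<open>M\<^sup>2\<close>, and somewhere there \<open>poisson I\<close> is so small that the
      second term of \<open>garsia_Phi f\<close> is below \<open>(\<epsilon> / 2)\<^sup>2\<close>.\<close>
    have M_le: "M \<le> t" if t: "garsia_norm f \<le> ereal t" for t
    proof (rule field_le_epsilon)
      fix \<epsilon> :: real assume \<epsilon>: "\<epsilon> > 0"
      have "ereal (sqrt (garsia_Phi f 0)) \<le> ereal t"
        using t unfolding garsia_norm_def by (rule SUP_le_iff[THEN iffD1, rule_format]) simp
      hence t0: "0 \<le> t"
        using Phi_nonneg[of 0] by (simp add: order_trans[OF real_sqrt_ge_zero])
      have Phi_t: "garsia_Phi f w \<le> t\<^sup>2" if "cmod w < 1" for w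
      proof -
        have "ereal (sqrt (garsia_Phi f w)) \<le> ereal t"
          using t unfolding garsia_norm_def
          by (rule SUP_le_iff[THEN iffD1, rule_format]) (use that in simp)
        thus ?thesis using sqrt_le_D by simp
      qed
      have "(Q \<longlongrightarrow> Q z0) (at z0 within cball 0 1)"
        using Q_cont z0(1) by (auto simp: continuous_on_def)
      hence "(Q \<longlongrightarrow> Q z0) (at z0 within ball 0 1)"
        by (rule tendsto_within_subset) auto
      hence "\<forall>\<^sub>F w in at z0 within ball 0 1. M\<^sup>2 - \<epsilon>\<^sup>2 / 2 < Q w"
        using Qz0 \<epsilon> by (intro order_tendstoD(1)) (auto intro: less_le_trans[rotated])
      moreover have "0 < \<epsilon> / (2 * M)"
        using \<epsilon> M_pos by simp
      ultimately obtain w where w: "cmod w < 1" "cmod (poisson I w) < \<epsilon> / (2 * M)"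
          "M\<^sup>2 - \<epsilon>\<^sup>2 / 2 < Q w"
        using spectrum_innerD[OF z0(3)] by blast
      have "cmod (poisson I w) * cmod (poisson F w) \<le> \<epsilon> / (2 * M) * M"
        using w PF_le[OF w(1)] \<epsilon> M_pos by (intro mult_mono) auto
      hence "(cmod (poisson I w) * cmod (poisson F w))\<^sup>2 \<le> (\<epsilon> / 2)\<^sup>2"
        using M_pos by (intro power_mono) auto
      also have "(\<epsilon> / 2)\<^sup>2 = \<epsilon>\<^sup>2 / 4"
        by (simp add: power_divide)
      finally have "M\<^sup>2 - \<epsilon>\<^sup>2 \<le> t\<^sup>2"
        using w(3) Phi[OF w(1)] Phi_t[OF w(1)] zero_le_power2[of \<epsilon>] by linarith
      moreover have "t\<^sup>2 + \<epsilon>\<^sup>2 \<le> (t + \<epsilon>)\<^sup>2"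
        using t0 \<epsilon> by (simp add: power2_sum)
      ultimately have "M\<^sup>2 \<le> (t + \<epsilon>)\<^sup>2" by linarith
      thus "M \<le> t + \<epsilon>"
        by (rule power2_le_imp_le) (use t0 \<epsilon> in simp)
    qed
    have "ereal M \<le> garsia_norm f"
      by (rule ereal_le_real) (simp add: M_le)
    with norm_le show "garsia_norm f = ereal M"
      by (rule antisym)
  next
    assume ext: "garsia_norm f = ereal M"
    have "\<exists>z\<in>ball 0 1. M - inverse (real (Suc n)) < sqrt (garsia_Phi f z)" for n
    proof -
      have "ereal (M - inverse (real (Suc n))) < garsia_norm f"
        unfolding ext by simp
      thus ?thesis
        unfolding garsia_norm_def less_SUP_iff by simp
    qed
    hence "\<exists>x. \<forall>n. x n \<in> ball 0 1 \<and> M - inverse (real (Suc n)) < sqrt (garsia_Phi f (x n))"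
      by (intro choice allI) blast
    then obtain x where x: "\<And>n. cmod (x n) < 1" "\<And>n. M - inverse (real (Suc n)) < sqrt (garsia_Phi f (x n))"
      by auto
    hence "\<forall>n. x n \<in> cball 0 1"
      by (simp add: less_imp_le)
    then obtain z0 s where z0: "z0 \<in> cball 0 1" and s: "strict_mono s" "(x \<circ> s) \<longlonglongrightarrow> z0"
      using compact_cball[of "0::complex" 1, unfolded compact_def, rule_format, of x] by blast
    define y where "y = x \<circ> s"
    have y: "cmod (y n) < 1" "y \<longlonglongrightarrow> z0" for n
      using x(1) s(2) by (auto simp: y_def)
    have "(\<lambda>n. sqrt (garsia_Phi f (x n))) \<longlonglongrightarrow> M"
    proof (rule tendsto_sandwich)
      show "(\<lambda>n. M - inverse (real (Suc n))) \<longlonglongrightarrow> M"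
        using tendsto_diff[OF tendsto_const LIMSEQ_inverse_real_of_nat, of M] by simp
      show "\<forall>\<^sub>F n in sequentially. sqrt (garsia_Phi f (x n)) \<le> M"
        using Phi_le x(1) M_pos by (intro always_eventually allI real_le_lsqrt) auto
    qed (use x(2) in \<open>auto intro!: always_eventually less_imp_le\<close>)
    hence "(\<lambda>n. (sqrt (garsia_Phi f (x n)))\<^sup>2) \<longlonglongrightarrow> M\<^sup>2"
      by (rule tendsto_power)
    hence "(\<lambda>n. garsia_Phi f (x n)) \<longlonglongrightarrow> M\<^sup>2"
      using Phi_nonneg x(1) by simp
    from LIMSEQ_subseq_LIMSEQ[OF this s(1)]
    have Phi_lim: "(\<lambda>n. garsia_Phi f (y n)) \<longlonglongrightarrow> M\<^sup>2"
      by (simp add: o_def y_def)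
    have ycball: "\<forall>\<^sub>F n in sequentially. y n \<in> cball 0 1"
      using y(1) by (auto intro: always_eventually less_imp_le)
    have Q_lim: "(\<lambda>n. Q (y n)) \<longlonglongrightarrow> M\<^sup>2"
    proof (rule tendsto_sandwich[OF _ _ Phi_lim tendsto_const])
      show "\<forall>\<^sub>F n in sequentially. garsia_Phi f (y n) \<le> Q (y n)"
        using Phi[OF y(1)] by (intro always_eventually allI) simp
      show "\<forall>\<^sub>F n in sequentially. Q (y n) \<le> M\<^sup>2"
        using Q_le y(1) by (intro always_eventually allI) simp
    qed
    have "(\<lambda>n. Q (y n)) \<longlonglongrightarrow> Q z0"
      by (rule continuous_on_tendsto_compose[OF Q_cont y(2) z0 ycball])
    hence "Q z0 = M\<^sup>2"
      using Q_lim LIMSEQ_unique by blast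
    hence Fz0: "cmod (poisson_ext F z0) = M"
      using z0 nz M_pos M(2) unfolding Q_def by (intro cmod_poisson_ext_eq_max[OF F]) auto
    have "(\<lambda>n. sqrt (Q (y n) - garsia_Phi f (y n))) \<longlonglongrightarrow> sqrt (M\<^sup>2 - M\<^sup>2)"
      by (intro tendsto_intros Q_lim Phi_lim)
    hence prod_lim: "(\<lambda>n. cmod (poisson I (y n)) * cmod (poisson F (y n))) \<longlonglongrightarrow> 0"
      by (simp add: Phi y(1))
    have "(\<lambda>n. cmod (poisson_ext F (y n))) \<longlonglongrightarrow> M"
      unfolding Fz0[symmetric]
      by (intro tendsto_norm continuous_on_tendsto_compose[OF disk_algebraD(3)[OF F] y(2) z0 ycball])
    hence "(\<lambda>n. cmod (poisson F (y n))) \<longlonglongrightarrow> M"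
      by (simp add: poisson_ext_ball y(1))
    from tendsto_divide[OF prod_lim this] have "(\<lambda>n. cmod (poisson I (y n))) \<longlonglongrightarrow> 0"
      using M_pos nz[OF y(1)] by simp
    hence "(\<lambda>n. poisson I (y n)) \<longlonglongrightarrow> 0"
      by (simp add: tendsto_norm_zero_iff)
    hence "z0 \<in> spectrum_inner I"
      using y inner_functionD(4)[OF I]
      by (intro spectrum_innerI[where x=y] holomorphic_on_imp_continuous_on) auto
    moreover have "z0 \<in> max_modulus_set F"
      using z0 Fz0 by (simp add: max_modulus_set_def closed_disk_ext_eq M(1))
    ultimately show "max_modulus_set F \<inter> spectrum_inner I \<noteq> {}" by blast
  qed
  finally show ?thesis by (simp add: f_def[abs_def])
qed

end
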